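(* There is a set $X \subseteq \omega^{\uparrow\omega}$ with $X \in w^0$ and $X \notin v^0$, i.e. $w^0 \setminus v^0 \neq \emptyset$.
   Context: $\omega^{\uparrow<\omega}$ denotes the set of strictly increasing finite sequences of natural numbers and $\omega^{\uparrow\omega}$ the set of strictly increasing infinite sequences (identified with infinite subsets of $\omega$ via increasing enumeration). A tree is a nonempty subset $T\subseteq\omega^{\uparrow<\omega}$ closed under initial segments; $[T]$ is its set of infinite branches in $\omega^{\uparrow\omega}$. For a family $\mathbb P$ of trees, the associated ideal consists of all $X\subseteq\omega^{\uparrow\omega}$ such that for every $T\in\mathbb P$ there is $T'\in\mathbb P$ with $T'\subseteq T$ and $[T']\cap X=\emptyset$. A willow tree is determined by a sequence $A=\{a_n;n\in\omega\}$ of nonempty finite subsets of $\omega$ with $\max a_n<\min a_{n+1}$ and a function $f:\omega\setminus\bigcup A\to 2$; it is the tree of all finite initial segments of increasing enumerations of infinite sets $x\subseteq\omega$ with $x\setminus\bigcup A=f^{-1}(\{1\})$ and, for each $n$, either $a_n\subseteq x$ or $a_n\cap x=\emptyset$; $w^0$ is the ideal associated with willow trees. A Silver tree is determined by a partial function $f$ from $\omega$ to $2$ with coinfinite domain; it is the tree of all finite initial segments of increasing enumerations of infinite sets $x\subseteq\omega$ with $x\cap\operatorname{dom}(f)=f^{-1}(\{1\})$; $v^0$ is the ideal associated with Silver trees. *)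

theory Defs
  imports Main "HOL-Library.Infinite_Set" "HOL-Library.Sublist"
begin

definition incr_fin :: "nat list set" where
  "incr_fin = {s. sorted_wrt (<) s}"

definition incr_inf :: "(nat \<Rightarrow> nat) set" where
  "incr_inf = {x. strict_mono x}"

definition init_seg :: "(nat \<Rightarrow> nat) \<Rightarrow> nat \<Rightarrow> nat list" where
  "init_seg x n = map x [0..<n]"

definition is_tree :: "nat list set \<Rightarrow> bool" where
  "is_tree T \<longleftrightarrow> T \<noteq> {} \<and> T \<subseteq> incr_fin \<and> (\<forall>t\<in>T. \<forall>s. prefix s t \<longrightarrow> s \<in> T)"

definition branches :: "nat list set \<Rightarrow> (nat \<Rightarrow> nat) set" where
  "branches T = {x \<in> incr_inf. \<forall>n. init_seg x n \<in> T}"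

definition assoc_ideal :: "nat list set set \<Rightarrow> (nat \<Rightarrow> nat) set set" where
  "assoc_ideal P = {X. X \<subseteq> incr_inf \<and>
     (\<forall>T\<in>P. \<exists>T'\<in>P. T' \<subseteq> T \<and> branches T' \<inter> X = {})}"

(* The identification of infinite subsets of the natural numbers with their increasing
   enumerations is made by enumerate, which is only meaningful on infinite sets. *)
definition tree_of :: "nat set set \<Rightarrow> nat list set" where
  "tree_of S = {init_seg (enumerate x) n | x n. x \<in> S}"

(* Functions into 2 with domain D are maps f :: nat \<rightharpoonup> bool with dom f = D,
   where True stands for 1; thus {k. f k = Some True} is the preimage of {1}. *)
definition willow_param :: "(nat \<Rightarrow> nat set) \<Rightarrow> (nat \<rightharpoonup> bool) \<Rightarrow> bool" where
  "willow_param a f \<longleftrightarrow>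
     (\<forall>n. finite (a n) \<and> a n \<noteq> {}) \<and>
     (\<forall>n. Max (a n) < Min (a (Suc n))) \<and>
     dom f = - (\<Union>n. a n)"

definition willow_sets :: "(nat \<Rightarrow> nat set) \<Rightarrow> (nat \<rightharpoonup> bool) \<Rightarrow> nat set set" where
  "willow_sets a f = {x. infinite x \<and> x - (\<Union>n. a n) = {k. f k = Some True} \<and>
     (\<forall>n. a n \<subseteq> x \<or> a n \<inter> x = {})}"

definition willow_trees :: "nat list set set" where
  "willow_trees = {tree_of (willow_sets a f) | a f. willow_param a f}"

definition silver_sets :: "(nat \<rightharpoonup> bool) \<Rightarrow> nat set set" where
  "silver_sets f = {x. infinite x \<and> x \<inter> dom f = {k. f k = Some True}}"

definition silver_trees :: "nat list set set" where
  "silver_trees = {tree_of (silver_sets f) | f. infinite (- dom f)}"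

definition w0 :: "(nat \<Rightarrow> nat) set set" where
  "w0 = assoc_ideal willow_trees"

definition v0 :: "(nat \<Rightarrow> nat) set set" where
  "v0 = assoc_ideal silver_trees"

lemma is_tree_tree_of:
  assumes "S \<noteq> {}" "\<And>x. x \<in> S \<Longrightarrow> infinite x"
  shows "is_tree (tree_of S)"
  unfolding is_tree_def
proof (intro conjI ballI allI impI)
  show "tree_of S \<noteq> {}"
    using assms(1) by (auto simp: tree_of_def)
  show "tree_of S \<subseteq> incr_fin"
    using assms(2)
    by (auto simp: tree_of_def init_seg_def incr_fin_def sorted_wrt_iff_nth_less enumerate_mono)
  fix t s assume "t \<in> tree_of S" "prefix s t"
  then obtain x n where x: "x \<in> S" "t = init_seg (enumerate x) n"
    by (auto simp: tree_of_def)
  have "s = take (length s) t" "length s \<le> n"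
    using \<open>prefix s t\<close> x(2) prefix_length_le[of s t] by (auto simp: prefix_def init_seg_def)
  hence "s = init_seg (enumerate x) (length s)"
    using x(2) by (simp add: init_seg_def take_map)
  thus "s \<in> tree_of S"
    using x(1) unfolding tree_of_def by blast
qed

lemma is_tree_willow:
  assumes "T \<in> willow_trees"
  shows "is_tree T"
proof -
  obtain a f where T: "T = tree_of (willow_sets a f)" and p: "willow_param a f"
    using assms by (auto simp: willow_trees_def)
  let ?x = "(\<Union>n. a n) \<union> {k. f k = Some True}"
  have "\<exists>m. m \<ge> n \<and> m \<in> a n" for n
  proof (induction n)
    case 0
    then show ?case using p by (auto simp: willow_param_def)
  next
    case (Suc n)
    then obtain m where m: "m \<ge> n" "m \<in> a n" by blast
    have "m \<le> Max (a n)" "Max (a n) < Min (a (Suc n))" "Min (a (Suc n)) \<in> a (Suc n)"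
      using p m by (auto simp: willow_param_def)
    thus ?case using m by (intro exI[of _ "Min (a (Suc n))"]) linarith
  qed
  hence "infinite ?x"
    unfolding infinite_nat_iff_unbounded_le by blast
  moreover have "f k \<noteq> Some True" if "k \<in> a n" for k n
  proof
    assume "f k = Some True"
    hence "k \<in> dom f" by blast
    thus False using that p by (auto simp: willow_param_def simp del: domIff)
  qed
  ultimately have "?x \<in> willow_sets a f"
    by (auto simp: willow_sets_def)
  thus ?thesis
    unfolding T by (intro is_tree_tree_of) (auto simp: willow_sets_def)
qed

lemma is_tree_silver:
  assumes "T \<in> silver_trees"
  shows "is_tree T"
proof -
  obtain f where T: "T = tree_of (silver_sets f)" and i: "infinite (- dom f)"
    using assms by (auto simp: silver_trees_def)
  have "- dom f \<union> {k. f k = Some True} \<in> silver_sets f"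
    using i by (auto simp: silver_sets_def)
  thus ?thesis
    unfolding T by (intro is_tree_tree_of) (auto simp: silver_sets_def)
qed

end

theory Submission imports Defs "HOL-Library.Countable" begin

text \<open>
  The set \<open>X\<close> is built by a recursion of length continuum over all trees, along which a branch is
  chosen in every Silver tree and a willow subtree in every willow tree, each avoiding what has been
  chosen earlier. A willow tree has continuum many willow subtrees with pairwise disjoint sets of
  branches, so fewer than continuum many points can be avoided; moreover the blocks \<open>a\<^sub>n\<close> of the
  subtree can be taken to have at least two elements. Conversely, every Silver tree has continuum
  many branches no two of which lie in a common willow tree of that kind: between two points of such
  a tree the symmetric difference is a union of blocks, so its first two elements cannot lie
  on different sides. Hence fewer than continuum many of these willow trees never cover the
  branches of a Silver tree.
\<close>

unbundle cardinal_syntax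

section \<open>Order of blocks, and what the branches of a generated tree determine\<close>

lemma willow_param_less:
  assumes "willow_param a f" "i < j" "u \<in> a i" "v \<in> a j"
  shows "u < v"
proof -
  have fin: "finite (a n)" for n
    using assms(1) by (simp add: willow_param_def)
  have "Max (a i) < Min (a j)"
    using \<open>i < j\<close>
  proof (induction j rule: less_Suc_induct)
    case (1 n)
    then show ?case using assms(1) by (simp add: willow_param_def)
  next
    case (2 i j k)
    have "Min (a j) \<le> Max (a j)"
      using assms(1) by (simp add: willow_param_def)
    with 2 show ?case by linarith
  qed
  moreover have "u \<le> Max (a i)" "Min (a j) \<le> v"
    using fin assms by auto
  ultimately show ?thesis by linarith
qed

lemma enumerate_in_branches:
  assumes "y \<in> S" "infinite y"
  shows "enumerate y \<in> branches (tree_of S)"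
  using assms
  by (auto simp: branches_def incr_inf_def tree_of_def strict_mono_def enumerate_mono)

lemma tree_of_mono: "S \<subseteq> S' \<Longrightarrow> tree_of S \<subseteq> tree_of S'"
  by (auto simp: tree_of_def)

text \<open>Since \<open>i \<le> x i\<close>, the value \<open>k\<close> can occur only at an index
  at most \<open>k\<close>, so the first \<open>k + 1\<close> values decide whether it
  occurs.\<close>

lemma init_seg_eq_imp_range_agree:
  assumes "strict_mono x" "strict_mono y" "init_seg x (Suc k) = init_seg y (Suc k)"
  shows "k \<in> range x \<longleftrightarrow> k \<in> range y"
proof -
  have eq: "x i = y i" if "i \<le> k" for i
    using arg_cong[OF assms(3), of "\<lambda>l. l ! i"] that by (simp add: init_seg_def del: upt_Suc)
  have "i \<le> x i" "i \<le> y i" for i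
    using assms(1,2) by (auto intro: strict_mono_imp_increasing)
  thus ?thesis using eq by (metis rangeE rangeI)
qed

text \<open>A branch of \<open>tree_of S\<close> need not enumerate a member of \<open>S\<close>:
  its initial segments come from members that may vary with the length. What remains is one member
  for each bound \<open>N\<close>.\<close>

lemma branches_tree_of_approx:
  assumes "x \<in> branches (tree_of S)" "\<And>y. y \<in> S \<Longrightarrow> infinite y"
  shows "\<exists>y\<in>S. \<forall>k\<le>N. k \<in> range x \<longleftrightarrow> k \<in> y"
proof -
  have "init_seg x (Suc N) \<in> tree_of S" and x: "strict_mono x"
    using assms(1) by (auto simp: branches_def incr_inf_def)
  then obtain y m where y: "y \<in> S" "init_seg x (Suc N) = init_seg (enumerate y) m"
    by (auto simp: tree_of_def)
  have inf: "infinite y" using assms(2) y(1) .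
  have "m = Suc N"
    using arg_cong[OF y(2), of length] by (simp add: init_seg_def)
  have "k \<in> range x \<longleftrightarrow> k \<in> y" if "k \<le> N" for k
  proof -
    have "init_seg z (Suc k) = take (Suc k) (init_seg z (Suc N))" for z
      using that by (simp add: init_seg_def take_map del: upt_Suc)
    hence "init_seg x (Suc k) = init_seg (enumerate y) (Suc k)"
      using y(2) \<open>m = Suc N\<close> by simp
    moreover have "strict_mono (enumerate y)"
      using inf by (simp add: strict_mono_def enumerate_mono)
    ultimately have "k \<in> range x \<longleftrightarrow> k \<in> range (enumerate y)"
      using x init_seg_eq_imp_range_agree by blast
    thus ?thesis using inf by (simp add: range_enumerate)
  qed
  with y(1) show ?thesis by blast
qed

text \<open>Willow sets are closed under these approximations, as each condition on membership
  concerns one number or one finite block. Infinity of the range comes from strict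
  monotonicity.\<close>

lemma range_branch_willow:
  assumes p: "willow_param a f" and x: "x \<in> branches (tree_of (willow_sets a f))"
  shows "range x \<in> willow_sets a f"
proof -
  have inf: "\<And>y. y \<in> willow_sets a f \<Longrightarrow> infinite y"
    by (simp add: willow_sets_def)
  have "strict_mono x"
    using x by (simp add: branches_def incr_inf_def)
  hence "infinite (range x)"
    by (simp add: range_inj_infinite strict_mono_imp_inj_on)
  moreover have "k \<in> range x - (\<Union>n. a n) \<longleftrightarrow> k \<in> {k. f k = Some True}" for k
  proof -
    obtain y where "y \<in> willow_sets a f" "k \<in> range x \<longleftrightarrow> k \<in> y"
      using branches_tree_of_approx[OF x inf] by blast
    thus ?thesis unfolding willow_sets_def by blast
  qed
  moreover have "a n \<subseteq> range x \<or> a n \<inter> range x = {}" for n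
  proof -
    obtain y where y_willow: "y \<in> willow_sets a f"
      and y: "\<forall>k\<le>Max (a n). k \<in> range x \<longleftrightarrow> k \<in> y"
      using branches_tree_of_approx[OF x inf] by blast
    have "k \<in> range x \<longleftrightarrow> k \<in> y" if "k \<in> a n" for k
      using that p y by (simp add: willow_param_def)
    moreover have "a n \<subseteq> y \<or> a n \<inter> y = {}"
      using y_willow by (simp add: willow_sets_def)
    ultimately show ?thesis by (meson disjoint_iff subset_iff)
  qed
  ultimately show ?thesis
    unfolding willow_sets_def by (intro CollectI conjI set_eqI allI)
qed

section \<open>Thick willow trees against Silver trees\<close>

text \<open>Every Silver tree is a willow tree with singleton blocks; demanding two elements per
  block excludes such presentations.\<close>

definition thick_willow_trees :: "nat list set set" where
  "thick_willow_trees = {tree_of (willow_sets a f) | a f.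
     willow_param a f \<and> (\<forall>n. \<forall>k. \<exists>l\<in>a n. l \<noteq> k)}"

text \<open>Both \<open>u\<close> and \<open>v\<close> lie in blocks, as \<open>x\<close> and
  \<open>y\<close> agree elsewhere. The whole block of \<open>u\<close> lies in \<open>x\<close> and
  misses \<open>y\<close>, so a second element \<open>u'\<close> of it is again a difference, hence
  beyond \<open>v\<close>. Then \<open>v\<close>, from another block, lies between two elements of
  the block of \<open>u\<close>, against the order of blocks.\<close>

lemma thick_willow_sets_first_differences:
  assumes p: "willow_param a f" and thick: "\<And>n k. \<exists>l\<in>a n. l \<noteq> k"
    and x: "x \<in> willow_sets a f" and y: "y \<in> willow_sets a f"
    and u: "u \<in> x - y" and v: "v \<in> y - x" and "u < v"
    and agree: "\<And>k. k < v \<Longrightarrow> k \<noteq> u \<Longrightarrow> k \<in> x \<longleftrightarrow> k \<in> y"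
  shows False
proof -
  have "x - (\<Union>n. a n) = y - (\<Union>n. a n)"
    using x y by (simp add: willow_sets_def)
  then obtain i j where i: "u \<in> a i" and j: "v \<in> a j"
    using u v by blast
  obtain u' where u': "u' \<in> a i" "u' \<noteq> u"
    using thick by blast
  have sub: "a i \<subseteq> x" "a i \<inter> y = {}"
    using x y i u by (auto simp: willow_sets_def)
  have "u' > v"
    using agree[of u'] sub u' v by (metis DiffD1 disjoint_iff linorder_neqE_nat subsetD)
  moreover have "i \<noteq> j" using sub v j by blast
  ultimately show False
    using willow_param_less[OF p, of i j u' v] willow_param_less[OF p, of j i v u] i j u'
      \<open>u < v\<close> by linarith
qed

text \<open>The free positions are paired as \<open>d (2 * n)\<close> and
  \<open>d (2 * n + 1)\<close>, and \<open>g\<close> decides which one of each pair is taken. At the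
  least number where \<open>g\<close> and \<open>h\<close> differ, the first two differences form
  one pair and lie on opposite sides.\<close>

lemma silver_branches_scattered:
  assumes "T \<in> silver_trees"
  obtains b :: "nat set \<Rightarrow> nat \<Rightarrow> nat" where "\<And>g. b g \<in> branches T"
    "\<And>g h W. W \<in> thick_willow_trees \<Longrightarrow> b g \<in> branches W \<Longrightarrow> b h \<in> branches W \<Longrightarrow> g = h"
proof -
  obtain f where T: "T = tree_of (silver_sets f)" and inf: "infinite (- dom f)"
    using assms by (auto simp: silver_trees_def)
  define d where "d = enumerate (- dom f)"
  have d: "strict_mono d"
    using inf by (simp add: d_def strict_mono_def enumerate_mono)
  have d_less: "d i < d j \<longleftrightarrow> i < j" and d_eq: "d i = d j \<longleftrightarrow> i = j" for i j
    using d by (auto simp: strict_mono_less strict_mono_eq)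
  have d_dom: "d i \<notin> dom f" for i
    using enumerate_in_set[OF inf, of i] by (simp add: d_def)
  define J :: "nat set \<Rightarrow> nat set" where "J g = {j. odd j \<longleftrightarrow> j div 2 \<in> g}" for g
  define s where "s g = {k. f k = Some True} \<union> d ` J g" for g
  have "infinite (J g)" for g
    unfolding infinite_nat_iff_unbounded_le
  proof
    fix m
    have "2 * m + of_bool (m \<in> g) \<in> J g" by (auto simp: J_def)
    thus "\<exists>n\<ge>m. n \<in> J g" by (intro exI[of _ "2 * m + of_bool (m \<in> g)"]) auto
  qed
  hence s_inf: "infinite (s g)" for g
    using d_eq by (simp add: s_def finite_image_iff inj_on_def)
  have s_silver: "s g \<in> silver_sets f" for g
    using s_inf d_dom by (auto simp: silver_sets_def s_def)
  have d_s: "d j \<in> s g \<longleftrightarrow> (odd j \<longleftrightarrow> j div 2 \<in> g)" for j g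
    using d_dom[of j] by (auto simp: s_def J_def d_eq)
  have sep: False
    if W: "W \<in> thick_willow_trees" "enumerate (s g) \<in> branches W" "enumerate (s h) \<in> branches W"
      and n: "n \<notin> g" "n \<in> h" and below: "\<And>m. m < n \<Longrightarrow> m \<in> g \<longleftrightarrow> m \<in> h" for W g h n
  proof -
    obtain a e where W_eq: "W = tree_of (willow_sets a e)" and p: "willow_param a e"
      and thick: "\<And>n k. \<exists>l\<in>a n. l \<noteq> k"
      using W(1) by (auto simp: thick_willow_trees_def)
    have "s g \<in> willow_sets a e" "s h \<in> willow_sets a e"
      using range_branch_willow[OF p] W(2,3) s_inf unfolding W_eq by (metis range_enumerate)+
    moreover have "d (2 * n) \<in> s g - s h" "d (Suc (2 * n)) \<in> s h - s g"
      using n by (simp_all add: d_s)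
    moreover have "k \<in> s g \<longleftrightarrow> k \<in> s h" if k: "k < d (Suc (2 * n))" "k \<noteq> d (2 * n)" for k
    proof (cases "k \<in> range d")
      case True
      then obtain j where j: "k = d j" by blast
      \<comment> \<open>An index below \<open>2 * n + 1\<close> other than \<open>2 * n\<close>
        belongs to an earlier pair, where the choices coincide.\<close>
      with k have "j div 2 < n" by (auto simp: d_less d_eq)
      thus ?thesis using below by (simp add: j d_s)
    next
      case False
      thus ?thesis by (auto simp: s_def)
    qed
    ultimately show False
      using thick_willow_sets_first_differences[OF p thick] d_less[of "2 * n" "Suc (2 * n)"]
      by blast
  qed
  show ?thesis
  proof (rule that)
    show "enumerate (s g) \<in> branches T" for g
      unfolding T using s_silver s_inf by (rule enumerate_in_branches)
    fix g h W
    assume W: "W \<in> thick_willow_trees"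
      "enumerate (s g) \<in> branches W" "enumerate (s h) \<in> branches W"
    show "g = h"
    proof (rule ccontr)
      assume "g \<noteq> h"
      then obtain m where "(m \<in> g) \<noteq> (m \<in> h)" by blast
      then obtain n where n: "(n \<in> g) \<noteq> (n \<in> h)"
        and below: "\<And>m. m < n \<Longrightarrow> (m \<in> g) = (m \<in> h)"
        using exists_least_iff[of "\<lambda>m. (m \<in> g) \<noteq> (m \<in> h)"] by blast
      show False
        using sep[OF W] sep[OF W(1,3,2)] n below by blast
    qed
  qed
qed

section \<open>Continuum many disjoint thick subtrees of a willow tree\<close>

lemma willow_disjoint_thick_subtrees:
  assumes "T \<in> willow_trees"
  obtains w :: "nat set \<Rightarrow> nat list set" where
    "\<And>g. w g \<in> thick_willow_trees" "\<And>g. w g \<subseteq> T"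
    "\<And>g h x. x \<in> branches (w g) \<Longrightarrow> x \<in> branches (w h) \<Longrightarrow> g = h"
proof -
  obtain a f where T: "T = tree_of (willow_sets a f)" and p: "willow_param a f"
    using assms by (auto simp: willow_trees_def)
  have fin: "finite (a n)" and ne: "a n \<noteq> {}" for n
    using p by (auto simp: willow_param_def)
  have dom_f: "dom f = - (\<Union>n. a n)"
    using p by (simp add: willow_param_def)
  have uniq: "i = j" if "k \<in> a i" "k \<in> a j" for i j k
    using willow_param_less[OF p, of i j k k] willow_param_less[OF p, of j i k k] that by force
  define b where "b n = a (3 * n) \<union> a (3 * n + 1)" for n
  define e where "e g k = (if \<exists>n. k \<in> a (3 * n + 2) then Some (\<exists>n\<in>g. k \<in> a (3 * n + 2)) else f k)"
    for g :: "nat set" and k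
  have b_less: "u < v" if uv: "u \<in> b n" "v \<in> b (Suc n)" for u v n
  proof -
    obtain i where "u \<in> a i" "i = 3 * n \<or> i = 3 * n + 1"
      using uv(1) unfolding b_def by blast
    moreover obtain j where "v \<in> a j" "j = 3 * Suc n \<or> j = 3 * Suc n + 1"
      using uv(2) unfolding b_def by blast
    moreover from calculation have "i < j" by auto
    ultimately show ?thesis using willow_param_less[OF p] by blast
  qed
  have split: "(\<Union>n. a n) = (\<Union>n. b n) \<union> (\<Union>n. a (3 * n + 2))"
  proof -
    have "a i \<subseteq> (\<Union>n. b n) \<union> (\<Union>n. a (3 * n + 2))" for i
    proof -
      have "i = 3 * (i div 3) \<or> i = 3 * (i div 3) + 1 \<or> i = 3 * (i div 3) + 2" by linarith
      hence "a i \<subseteq> b (i div 3) \<or> a i \<subseteq> a (3 * (i div 3) + 2)"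
        unfolding b_def by (metis Un_upper1 Un_upper2 order_refl)
      thus ?thesis by blast
    qed
    moreover have "b n \<subseteq> (\<Union>n. a n)" for n
      unfolding b_def by blast
    ultimately show ?thesis by blast
  qed
  have a_iff: "k \<in> (\<Union>n. a n) \<longleftrightarrow> k \<in> (\<Union>n. b n) \<or> (\<exists>n. k \<in> a (3 * n + 2))" for k
    unfolding split by blast
  have b_not: "k \<notin> a (3 * m + 2)" if "k \<in> b n" for k n m
  proof
    assume k: "k \<in> a (3 * m + 2)"
    have "3 * m + 2 = 3 * n \<or> 3 * m + 2 = 3 * n + 1"
      using that uniq[OF k] unfolding b_def by blast
    thus False by presburger
  qed
  have e_fixed: "e g k = Some (n \<in> g)" if k: "k \<in> a (3 * n + 2)" for g k n
  proof -
    have "m = n" if "k \<in> a (3 * m + 2)" for m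
      using uniq[OF that k] by simp
    hence "(\<exists>m\<in>g. k \<in> a (3 * m + 2)) \<longleftrightarrow> n \<in> g"
      using k by blast
    moreover have "\<exists>m. k \<in> a (3 * m + 2)"
      using k by blast
    ultimately show ?thesis by (simp only: e_def if_True)
  qed
  have e_eq: "e g k = f k" if "\<And>n. k \<notin> a (3 * n + 2)" for g k
    using that by (simp add: e_def del: add_2_eq_Suc')
  have dom_e: "dom (e g) = - (\<Union>n. b n)" for g
  proof -
    have "k \<in> dom (e g) \<longleftrightarrow> k \<notin> (\<Union>n. b n)" for k
    proof (cases "\<exists>n. k \<in> a (3 * n + 2)")
      case True
      then obtain n where n: "k \<in> a (3 * n + 2)" ..
      hence "k \<notin> (\<Union>n. b n)" using b_not by blast
      thus ?thesis using e_fixed[OF n] by (simp add: domIff)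
    next
      case False
      hence "e g k = f k" by (intro e_eq) blast
      hence "k \<in> dom (e g) \<longleftrightarrow> k \<in> dom f" by (simp add: domIff)
      also have "\<dots> \<longleftrightarrow> k \<notin> (\<Union>n. b n)"
        using False unfolding dom_f Compl_iff a_iff by blast
      finally show ?thesis .
    qed
    thus ?thesis by (intro set_eqI) (simp only: Compl_iff)
  qed
  have p': "willow_param b (e g)" for g
    using b_less fin ne dom_e unfolding willow_param_def by (auto simp: b_def)
  have thick: "\<exists>l\<in>b n. l \<noteq> k" for n k
  proof -
    obtain l l' where l: "l \<in> a (3 * n)" "l' \<in> a (3 * n + 1)"
      using ne[of "3 * n"] ne[of "3 * n + 1"] by blast
    hence "l < l'"
      using willow_param_less[OF p, of "3 * n" "3 * n + 1" l l'] by simp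
    hence "l \<noteq> k \<or> l' \<noteq> k" by linarith
    with l show ?thesis unfolding b_def by blast
  qed
  have off_blocks: "k \<in> x \<longleftrightarrow> e g k = Some True"
    if "x \<in> willow_sets b (e g)" "k \<notin> (\<Union>n. b n)" for x g k
  proof -
    have "x - (\<Union>n. b n) = {k. e g k = Some True}"
      using that(1) by (simp add: willow_sets_def)
    hence "k \<in> x - (\<Union>n. b n) \<longleftrightarrow> k \<in> {k. e g k = Some True}" by (simp only:)
    thus ?thesis using that(2) by simp
  qed
  have fixed: "k \<in> x \<longleftrightarrow> n \<in> g"
    if "x \<in> willow_sets b (e g)" "k \<in> a (3 * n + 2)" for x g n k
  proof -
    have "k \<notin> (\<Union>n. b n)" using b_not that(2) by blast
    thus ?thesis using off_blocks[OF that(1)] e_fixed[OF that(2)] by simp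
  qed
  have sub: "willow_sets b (e g) \<subseteq> willow_sets a f" for g
  proof
    fix x assume x: "x \<in> willow_sets b (e g)"
    have "k \<in> x - (\<Union>n. a n) \<longleftrightarrow> k \<in> {k. f k = Some True}" for k
    proof (cases "k \<in> (\<Union>n. a n)")
      case True
      hence "k \<notin> dom f" unfolding dom_f by blast
      with True show ?thesis by (simp add: domIff)
    next
      case False
      hence k: "k \<notin> (\<Union>n. b n)" "k \<notin> a (3 * n + 2)" for n
        unfolding a_iff by blast+
      from k(2) have "e g k = f k" by (rule e_eq)
      with False k(1) show ?thesis using off_blocks[OF x] by simp
    qed
    moreover have "a i \<subseteq> x \<or> a i \<inter> x = {}" for i
    proof -
      \<comment> \<open>An original block is either part of a merged block, taken wholly or not at
        all, or frozen with a constant value.\<close>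
      consider n where "a i \<subseteq> b n" | n where "i = 3 * n + 2"
      proof -
        have "i = 3 * (i div 3) \<or> i = 3 * (i div 3) + 1 \<or> i = 3 * (i div 3) + 2" by linarith
        hence "a i \<subseteq> b (i div 3) \<or> i = 3 * (i div 3) + 2"
          unfolding b_def by (metis Un_upper1 Un_upper2)
        thus ?thesis using that by blast
      qed
      thus ?thesis
      proof cases
        case 1
        moreover have "b n \<subseteq> x \<or> b n \<inter> x = {}"
          using x by (simp add: willow_sets_def)
        ultimately show ?thesis by blast
      next
        case 2
        then show ?thesis using fixed[OF x] by blast
      qed
    qed
    moreover have "infinite x"
      using x by (simp add: willow_sets_def)
    ultimately show "x \<in> willow_sets a f"
      unfolding willow_sets_def by (intro CollectI conjI set_eqI allI)
  qed
  show ?thesis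
  proof (rule that)
    fix g
    show "tree_of (willow_sets b (e g)) \<in> thick_willow_trees"
      unfolding thick_willow_trees_def using p' thick by blast
    show "tree_of (willow_sets b (e g)) \<subseteq> T"
      unfolding T using sub by (rule tree_of_mono)
  next
    fix g h x
    assume "x \<in> branches (tree_of (willow_sets b (e g)))"
      and "x \<in> branches (tree_of (willow_sets b (e h)))"
    hence x: "range x \<in> willow_sets b (e g)" "range x \<in> willow_sets b (e h)"
      using range_branch_willow p' by blast+
    have "n \<in> g \<longleftrightarrow> n \<in> h" for n
    proof -
      obtain k where "k \<in> a (3 * n + 2)" using ne[of "3 * n + 2"] by blast
      thus ?thesis using fixed x by blast
    qed
    thus "g = h" by blast
  qed
qed

section \<open>Counting, and the recursion over trees\<close>

lemma thick_willow_subset: "thick_willow_trees \<subseteq> willow_trees"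
  by (auto simp: thick_willow_trees_def willow_trees_def)

text \<open>Were every \<open>g\<close> related to some index, choosing one would be injective,
  since an index serves at most one \<open>g\<close>; so \<open>I\<close> would have size at least
  continuum.\<close>

lemma continuum_uncovered:
  fixes R :: "nat set \<Rightarrow> 'i \<Rightarrow> bool"
  assumes "|I| <o |UNIV :: nat list set set|"
    and "\<And>g h i. i \<in> I \<Longrightarrow> R g i \<Longrightarrow> R h i \<Longrightarrow> g = h"
  shows "\<exists>g. \<forall>i\<in>I. \<not> R g i"
proof (rule ccontr)
  assume "\<nexists>g. \<forall>i\<in>I. \<not> R g i"
  then obtain c where c: "\<And>g. c g \<in> I" "\<And>g. R g (c g)" by metis
  \<comment> \<open>Coding finite sequences by numbers carries sets of sequences injectively to sets
    of numbers.\<close>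
  let ?F = "\<lambda>T :: nat list set. c (to_nat ` T)"
  have "inj ?F"
  proof (rule injI)
    fix S T assume "?F S = ?F T"
    hence "to_nat ` S = to_nat ` T" using assms(2) c by metis
    thus "S = T" by (simp add: inj_image_eq_iff)
  qed
  hence "|UNIV :: nat list set set| \<le>o |I|"
    using c(1) card_of_ordLeq by blast
  thus False using assms(1) not_ordLess_ordLeq by blast
qed

theorem theorem2p7:
  "\<exists>X. X \<subseteq> incr_inf \<and> X \<in> w0 \<and> X \<notin> v0"
proof -
  \<comment> \<open>As a cardinal order on all sets of finite sequences, \<open>r\<close> gives each
    stage fewer than continuum many predecessors.\<close>
  define r where "r = |UNIV :: nat list set set|"
  have r: "Card_order r" "Field r = UNIV"
    unfolding r_def by (rule card_of_Card_order, rule Field_card_of)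
  have wo: "Well_order r" using r(1) by (simp add: card_order_on_def)
  hence wf: "wf (r - Id)" by (simp add: well_order_on_def)
  have total: "(S, T) \<in> r - Id \<or> (T, S) \<in> r - Id \<or> S = T" for S T
    using wo r(2) unfolding well_order_on_def linear_order_on_def total_on_def by blast
  have small: "|{S. (S, T) \<in> r - Id}| <o |UNIV :: nat list set set|" for T
  proof -
    have "{S. (S, T) \<in> r - Id} = underS r T" by (auto simp: underS_def)
    thus ?thesis using card_of_underS[OF r(1), of T] r(2) by (simp add: r_def)
  qed
  have inf: "infinite (UNIV :: nat list set set)"
    by (simp add: Finite_Set.finite_set infinite_UNIV_listI)
  \<comment> \<open>The pair \<open>z\<close> consists of the branch and the willow subtree chosen
    at stage \<open>T\<close>. The branch avoids earlier subtrees; the subtree avoids earlier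
    branches and the branch of its own stage. The guards are there because stages range over all
    sets of finite sequences.\<close>
  define P where "P F T z \<longleftrightarrow>
      (T \<in> silver_trees \<longrightarrow> fst z \<in> branches T \<and>
        (\<forall>S. (S, T) \<in> r - Id \<longrightarrow> S \<in> willow_trees \<longrightarrow> fst z \<notin> branches (snd (F S)))) \<and>
      (T \<in> willow_trees \<longrightarrow> snd z \<in> thick_willow_trees \<and> snd z \<subseteq> T \<and> fst z \<notin> branches (snd z) \<and>
        (\<forall>S. (S, T) \<in> r - Id \<longrightarrow> fst (F S) \<notin> branches (snd z)))"
    for F :: "nat list set \<Rightarrow> (nat \<Rightarrow> nat) \<times> nat list set" and T z
  have "\<exists>F. \<forall>T. P F T (F T)"
  proof (rule dependent_wf_choice[OF wf])
    show "P F T z = P G T z" if "\<And>S. (S, T) \<in> r - Id \<Longrightarrow> F S = G S" for F G T z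
      unfolding P_def using that by (smt (verit))
  next
    fix T F
    assume IH: "P F S (F S)" if "(S, T) \<in> r - Id" for S
    have "\<exists>x. T \<in> silver_trees \<longrightarrow> x \<in> branches T \<and>
        (\<forall>S. (S, T) \<in> r - Id \<longrightarrow> S \<in> willow_trees \<longrightarrow> x \<notin> branches (snd (F S)))"
    proof (cases "T \<in> silver_trees")
      case True
      then obtain b :: "nat set \<Rightarrow> nat \<Rightarrow> nat" where b: "\<And>g. b g \<in> branches T"
        "\<And>g h W. W \<in> thick_willow_trees \<Longrightarrow> b g \<in> branches W \<Longrightarrow> b h \<in> branches W \<Longrightarrow> g = h"
        using silver_branches_scattered by blast
      have "\<exists>g. \<forall>S\<in>{S. (S, T) \<in> r - Id}. \<not> (S \<in> willow_trees \<and> b g \<in> branches (snd (F S)))"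
      proof (rule continuum_uncovered[OF small])
        fix g h S
        assume S: "S \<in> {S. (S, T) \<in> r - Id}"
          and g: "S \<in> willow_trees \<and> b g \<in> branches (snd (F S))"
          and h: "S \<in> willow_trees \<and> b h \<in> branches (snd (F S))"
        \<comment> \<open>The induction hypothesis supplies thickness, so the earlier subtree has at
          most one \<open>b g\<close> as a branch.\<close>
        have "snd (F S) \<in> thick_willow_trees" using IH[of S] S g by (simp add: P_def)
        thus "g = h" using b(2) g h by blast
      qed
      with b(1) show ?thesis by blast
    qed blast
    then obtain x where x: "T \<in> silver_trees \<longrightarrow> x \<in> branches T \<and>
        (\<forall>S. (S, T) \<in> r - Id \<longrightarrow> S \<in> willow_trees \<longrightarrow> x \<notin> branches (snd (F S)))" ..
    have "\<exists>W. T \<in> willow_trees \<longrightarrow> W \<in> thick_willow_trees \<and> W \<subseteq> T \<and> x \<notin> branches W \<and>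
        (\<forall>S. (S, T) \<in> r - Id \<longrightarrow> fst (F S) \<notin> branches W)"
    proof (cases "T \<in> willow_trees")
      case True
      then obtain w :: "nat set \<Rightarrow> nat list set" where w:
        "\<And>g. w g \<in> thick_willow_trees" "\<And>g. w g \<subseteq> T"
        "\<And>g h x. x \<in> branches (w g) \<Longrightarrow> x \<in> branches (w h) \<Longrightarrow> g = h"
        using willow_disjoint_thick_subtrees by blast
      \<comment> \<open>The branch \<open>x\<close> of the present stage is included because
        \<open>T\<close> may be both a Silver and a willow tree.\<close>
      let ?Y = "{x} \<union> (\<lambda>S. fst (F S)) ` {S. (S, T) \<in> r - Id}"
      have "|{x}| <o |UNIV :: nat list set set|"
        using inf
      by (intro finite_ordLess_infinite) (simp_all add: card_of_well_order_on Field_card_of)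
      moreover have "|(\<lambda>S. fst (F S)) ` {S. (S, T) \<in> r - Id}| <o |UNIV :: nat list set set|"
        using card_of_image small by (rule ordLeq_ordLess_trans)
      ultimately have Y: "|?Y| <o |UNIV :: nat list set set|"
        by (rule card_of_Un_ordLess_infinite[OF inf])
      have "\<exists>g. \<forall>y\<in>?Y. y \<notin> branches (w g)"
        using w(3) by (intro continuum_uncovered[OF Y])
      then obtain g where "\<forall>y\<in>?Y. y \<notin> branches (w g)" ..
      with w(1,2) show ?thesis by blast
    qed blast
    then obtain W where "T \<in> willow_trees \<longrightarrow> W \<in> thick_willow_trees \<and> W \<subseteq> T \<and> x \<notin> branches W \<and>
        (\<forall>S. (S, T) \<in> r - Id \<longrightarrow> fst (F S) \<notin> branches W)" ..
    with x have "P F T (x, W)" by (simp add: P_def)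
    thus "\<exists>z. P F T z" ..
  qed
  then obtain F where F: "\<And>T. P F T (F T)" by blast
  define X where "X = (\<lambda>T. fst (F T)) ` silver_trees"
  have X_branch: "fst (F T) \<in> branches T" if "T \<in> silver_trees" for T
    using F[of T] that by (simp add: P_def)
  have "X \<subseteq> incr_inf"
    using X_branch by (auto simp: X_def branches_def)
  moreover have "X \<in> w0"
    unfolding w0_def assoc_ideal_def
  proof (intro CollectI conjI ballI)
    fix T assume T: "T \<in> willow_trees"
    have W: "snd (F T) \<in> thick_willow_trees" "snd (F T) \<subseteq> T"
      using F[of T] T by (auto simp: P_def)
    have "fst (F S) \<notin> branches (snd (F T))" if "S \<in> silver_trees" for S
      \<comment> \<open>The later of the two stages avoids the choice of the earlier one; for
        \<open>S = T\<close> the clause on the common stage applies.\<close>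
      using total[of S T] F[of S] F[of T] T that unfolding P_def by blast
    hence "branches (snd (F T)) \<inter> X = {}" by (auto simp: X_def)
    with W thick_willow_subset show "\<exists>T'\<in>willow_trees. T' \<subseteq> T \<and> branches T' \<inter> X = {}"
      by blast
  qed fact
  moreover have "X \<notin> v0"
  proof
    assume "X \<in> v0"
    \<comment> \<open>The ideal condition needs some Silver tree to start from; any subtree it
      returns is Silver and so meets \<open>X\<close>.\<close>
    moreover have "tree_of (silver_sets Map.empty) \<in> silver_trees"
      unfolding silver_trees_def by (intro CollectI exI[of _ Map.empty]) simp
    ultimately obtain T where T: "T \<in> silver_trees" "branches T \<inter> X = {}"
      unfolding v0_def assoc_ideal_def by blast
    thus False using X_branch by (auto simp: X_def)
  qed
  ultimately show ?thesis by blast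
qed

end
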